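(* Let $D$ be a diagonal rectangulation of size $n$, let $P$ be its adjacency poset, and let $x,y\in[n]$. Then $x\lessdot_P y$ if and only if rectangles $x$ and $y$ of $D$ form one of the following six configurations: (i) the upper-left corner of rectangle $x$ equals the lower-left corner of rectangle $y$, and the right side of rectangle $y$ lies strictly to the left of the (vertical line containing the) right side of rectangle $x$; (ii) the lower-right corner of rectangle $x$ equals the lower-left corner of rectangle $y$, and the top side of rectangle $y$ lies strictly below the (horizontal line containing the) top side of rectangle $x$; (iii) the top side of rectangle $x$ equals the bottom side of rectangle $y$; (iv) the right side of rectangle $x$ equals the left side of rectangle $y$; (v) the upper-right corner of rectangle $x$ equals the lower-right corner of rectangle $y$, and the left side of rectangle $x$ lies strictly to the right of the (vertical line containing the) left side of rectangle $y$; (vi) the upper-right corner of rectangle $x$ equals the upper-left corner of rectangle $y$, and the bottom side of rectangle $x$ lies strictly above the (horizontal line containing the) bottom side of rectangle $y$.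
   Context: **Diagonal rectangulations.** A diagonal rectangulation of size $n$ is a decomposition of the square $S=[0,n]\times[0,n]$ into $n$ axis-parallel rectangles such that the diagonal of $S$ from $(0,n)$ to $(n,0)$ contains an interior point of every rectangle and the edges of the decomposition meet this diagonal exactly in the equally spaced points $(i,n-i)$, $0\le i\le n$. The rectangles are labeled $1,\dots,n$ in the order in which they appear along the diagonal starting from the top-left corner; the one labeled $i$ is called rectangle $i$. **Adjacency poset.** The adjacency poset of a diagonal rectangulation of size $n$ is the poset on $[n]=\{1,\dots,n\}$ obtained by declaring $x<y$ whenever the interior of the bottom or left side of rectangle $y$ intersects the interior of the top or right side of rectangle $x$, and then taking the reflexive and transitive closure (these relations are acyclic, so this is a partial order). $x\lessdot_P y$ means $x<_P y$ and there is no $z$ with $x<_P z<_P y$. *)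

theory Defs
  imports "HOL-Analysis.Analysis"
begin

abbreviation xmin :: "(real \<times> real) set \<Rightarrow> real" where
  "xmin A \<equiv> fst (interval_lowerbound A)"
abbreviation xmax :: "(real \<times> real) set \<Rightarrow> real" where
  "xmax A \<equiv> fst (interval_upperbound A)"
abbreviation ymin :: "(real \<times> real) set \<Rightarrow> real" where
  "ymin A \<equiv> snd (interval_lowerbound A)"
abbreviation ymax :: "(real \<times> real) set \<Rightarrow> real" where
  "ymax A \<equiv> snd (interval_upperbound A)"

definition lower_left :: "(real \<times> real) set \<Rightarrow> real \<times> real" where
  "lower_left A = (xmin A, ymin A)"
definition lower_right :: "(real \<times> real) set \<Rightarrow> real \<times> real" where
  "lower_right A = (xmax A, ymin A)"
definition upper_left :: "(real \<times> real) set \<Rightarrow> real \<times> real" where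
  "upper_left A = (xmin A, ymax A)"
definition upper_right :: "(real \<times> real) set \<Rightarrow> real \<times> real" where
  "upper_right A = (xmax A, ymax A)"

definition bottom_side :: "(real \<times> real) set \<Rightarrow> (real \<times> real) set" where
  "bottom_side A = closed_segment (lower_left A) (lower_right A)"
definition top_side :: "(real \<times> real) set \<Rightarrow> (real \<times> real) set" where
  "top_side A = closed_segment (upper_left A) (upper_right A)"
definition left_side :: "(real \<times> real) set \<Rightarrow> (real \<times> real) set" where
  "left_side A = closed_segment (lower_left A) (upper_left A)"
definition right_side :: "(real \<times> real) set \<Rightarrow> (real \<times> real) set" where
  "right_side A = closed_segment (lower_right A) (upper_right A)"

definition edges :: "(real \<times> real) set set \<Rightarrow> (real \<times> real) set" where
  "edges D = (\<Union>A\<in>D. bottom_side A \<union> top_side A \<union> left_side A \<union> right_side A)"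

definition diagonal :: "nat \<Rightarrow> (real \<times> real) set" where
  "diagonal n = closed_segment (0, real n) (real n, 0)"

(* division_of admits degenerate boxes; the condition on interiors excludes them here. *)
definition diagonal_rectangulation :: "nat \<Rightarrow> (real \<times> real) set set \<Rightarrow> bool" where
  "diagonal_rectangulation n D \<longleftrightarrow>
     D division_of cbox (0, 0) (real n, real n) \<and>
     card D = n \<and>
     (\<forall>A\<in>D. interior A \<inter> diagonal n \<noteq> {}) \<and>
     edges D \<inter> diagonal n = {(real i, real n - real i) | i. i \<le> n}"

(* The diagonal runs from the top-left to the bottom-right corner, so the position of a point
   along it is measured by its first coordinate. For a diagonal rectangulation such an r
   exists, and it is unique on {1..n}. *)
definition diagonal_labelling ::
    "nat \<Rightarrow> (real \<times> real) set set \<Rightarrow> (nat \<Rightarrow> (real \<times> real) set) \<Rightarrow> bool" where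
  "diagonal_labelling n D r \<longleftrightarrow>
     bij_betw r {1..n} D \<and>
     (\<forall>i\<in>{1..n}. \<forall>j\<in>{1..n}. i < j \<longrightarrow>
        (\<forall>p \<in> interior (r i) \<inter> diagonal n. \<forall>q \<in> interior (r j) \<inter> diagonal n. fst p < fst q))"

(* A side has empty interior in the plane: its interior is the relative one. *)
definition adjacency :: "nat \<Rightarrow> (nat \<Rightarrow> (real \<times> real) set) \<Rightarrow> nat rel" where
  "adjacency n r = {(x, y). x \<in> {1..n} \<and> y \<in> {1..n} \<and>
     (rel_interior (bottom_side (r y)) \<union> rel_interior (left_side (r y))) \<inter>
     (rel_interior (top_side (r x)) \<union> rel_interior (right_side (r x))) \<noteq> {}}"

definition adjacency_poset :: "nat \<Rightarrow> (nat \<Rightarrow> (real \<times> real) set) \<Rightarrow> nat rel" where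
  "adjacency_poset n r = Restr ((adjacency n r)\<^sup>*) {1..n}"

definition strictly_below :: "'a rel \<Rightarrow> 'a \<Rightarrow> 'a \<Rightarrow> bool" where
  "strictly_below P x y \<longleftrightarrow> (x, y) \<in> P \<and> x \<noteq> y"

definition covered_by :: "'a rel \<Rightarrow> 'a \<Rightarrow> 'a \<Rightarrow> bool" where
  "covered_by P x y \<longleftrightarrow>
     strictly_below P x y \<and> \<not> (\<exists>z. strictly_below P x z \<and> strictly_below P z y)"

end

theory Submission imports Defs begin

text \<open>The rectangles have disjoint interiors, cover the square and each contain an interior point
  on the line \<open>x + y = n\<close>. These properties are
  invariant under transposition, which exchanges vertical and horizontal adjacencies, and under
  rotation by 180 degrees, which reverses adjacency, so most arguments treat a single case.
  Translation in a diagonal direction shows that adjacency is acyclic. A vertical adjacency of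
  \<open>x\<close> and \<open>y\<close> that is not one of the listed configurations either factors through the rectangle at
  an end of the common segment or makes a neighbouring rectangle miss the diagonal. In a listed
  configuration, a detour from \<open>x\<close> to \<open>y\<close> would have to cross the line through their
  aligned sides, which creates a cycle.\<close>

section \<open>Acyclicity by eliminating vertices\<close>

text \<open>A vertex without a loop all of whose passages \<open>p\<close>, \<open>x\<close>,
  \<open>s\<close> can be short-cut from \<open>p\<close> to \<open>s\<close> may be deleted: a
  cycle through it shrinks to a cycle that avoids it. Induction deletes such vertices one at a
  time.\<close>

lemma acyclic_elimination:
  assumes "finite S"
    and "\<And>U. U \<subseteq> S \<Longrightarrow> U \<noteq> {} \<Longrightarrow>
      \<exists>x\<in>U. (x, x) \<notin> R \<and> (\<forall>p\<in>U. \<forall>s\<in>U. (p, x) \<in> R \<longrightarrow> (x, s) \<in> R \<longrightarrow> (p, s) \<in> R)"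
  shows "acyclic (Restr R S)"
  using assms
proof (induction S rule: finite_psubset_induct)
  case (psubset S)
  show ?case
  proof (cases "S = {}")
    case True
    then show ?thesis by (simp add: acyclic_def)
  next
    case False
    then obtain x where x: "x \<in> S" "(x, x) \<notin> R"
      and bypass: "\<And>p s. p \<in> S \<Longrightarrow> s \<in> S \<Longrightarrow> (p, x) \<in> R \<Longrightarrow> (x, s) \<in> R \<Longrightarrow> (p, s) \<in> R"
      using psubset.prems by (metis order_refl)
    define T where "T = Restr R (S - {x})"
    have acT: "acyclic T"
      unfolding T_def
    proof (rule psubset.IH)
      show "S - {x} \<subset> S" using x by blast
    next
      fix U assume "U \<subseteq> S - {x}" "U \<noteq> {}"
      then show "\<exists>x\<in>U. (x, x) \<notin> R \<and>
          (\<forall>p\<in>U. \<forall>s\<in>U. (p, x) \<in> R \<longrightarrow> (x, s) \<in> R \<longrightarrow> (p, s) \<in> R)"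
        using psubset.prems by (meson Diff_subset order_trans)
    qed
    \<comment> \<open>Invariant of a walk starting away from \<open>x\<close>: while it stands at
      \<open>x\<close>, the vertex \<open>p\<close> before \<open>x\<close> is remembered, and the
      next step is replaced by the shortcut from \<open>p\<close>.\<close>
    have avoid: "(v \<noteq> x \<longrightarrow> (u, v) \<in> T\<^sup>+) \<and>
        (v = x \<longrightarrow> (\<exists>p\<in>S. p \<noteq> x \<and> (u, p) \<in> T\<^sup>* \<and> (p, x) \<in> R))"
      if "(u, v) \<in> (Restr R S)\<^sup>+" "u \<noteq> x" for u v
      using that
    proof (induction rule: trancl_induct)
      case (base v)
      then show ?case by (auto simp: T_def)
    next
      case (step v w)
      show ?case
      proof (cases "v = x")
        case True
        then obtain p where p: "p \<in> S" "p \<noteq> x" "(u, p) \<in> T\<^sup>*" "(p, x) \<in> R"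
          using step by blast
        have "w \<noteq> x" using True step.hyps x by auto
        moreover have "(p, w) \<in> T"
          using True step.hyps p bypass \<open>w \<noteq> x\<close> by (auto simp: T_def)
        ultimately show ?thesis
          using p by (meson rtrancl_into_trancl1)
      next
        case False
        then have uv: "(u, v) \<in> T\<^sup>+" using step by blast
        show ?thesis
        proof (cases "w = x")
          case True
          then show ?thesis
            using uv step.hyps False by (auto intro!: bexI[of _ v] trancl_into_rtrancl)
        next
          case wx: False
          then have "(v, w) \<in> T" using step.hyps False by (auto simp: T_def)
          then show ?thesis using uv wx by (meson trancl.trancl_into_trancl)
        qed
      qed
    qed
    have "(u, u) \<notin> (Restr R S)\<^sup>+" if "u \<noteq> x" for u
      using avoid[of u u] that acT by (auto simp: acyclic_def)
    moreover have "(x, x) \<notin> (Restr R S)\<^sup>+"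
    proof
      assume "(x, x) \<in> (Restr R S)\<^sup>+"
      \<comment> \<open>A cycle through \<open>x\<close> is read from the vertex after
        \<open>x\<close>, so that the invariant applies.\<close>
      then obtain s where s: "(x, s) \<in> Restr R S" "(s, x) \<in> (Restr R S)\<^sup>*"
        by (meson tranclD)
      then have "(s, s) \<in> (Restr R S)\<^sup>+" by (meson rtrancl_into_trancl1)
      moreover have "s \<noteq> x" using s x by auto
      ultimately show False using avoid[of s s] acT by (auto simp: acyclic_def)
    qed
    ultimately show ?thesis unfolding acyclic_def by metis
  qed
qed

section \<open>Gaps between finitely many coordinates\<close>

lemma gap_below:
  fixes F :: "real set" and l p :: real
  assumes "finite F" "l < p"
  obtains p' where "l < p'" "p' < p" "F \<inter> {p'..<p} = {}"
proof -
  \<comment> \<open>Inserting \<open>l\<close> makes the set nonempty and keeps the midpoint of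
    \<open>m\<close> and \<open>p\<close> above \<open>l\<close>.\<close>
  define m where "m = Max (insert l {f\<in>F. f < p})"
  have fin: "finite (insert l {f\<in>F. f < p})" using assms by simp
  have "m < p" unfolding m_def using fin assms by (subst Max_less_iff) auto
  moreover have "l \<le> m" unfolding m_def using fin by (intro Max_ge) auto
  moreover have "F \<inter> {(m + p) / 2..<p} = {}"
  proof -
    have le: "f \<le> m" if "f \<in> F" "f < p" for f
      unfolding m_def using fin that by (intro Max_ge) auto
    have "f < (m + p) / 2" if "f \<in> F" "f < p" for f
      using le[OF that] \<open>m < p\<close> by simp
    then show ?thesis by fastforce
  qed
  ultimately show thesis by (intro that[of "(m + p) / 2"]) simp_all
qed

lemma gap_above:
  fixes F :: "real set" and p u :: real
  assumes "finite F" "p < u"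
  obtains p' where "p < p'" "p' < u" "F \<inter> {p<..p'} = {}"
proof -
  obtain q where q: "- u < q" "q < - p" "uminus ` F \<inter> {q..<- p} = {}"
    using gap_below[of "uminus ` F" "- u" "- p"] assms by auto
  have "\<not> (f \<in> F \<and> p < f \<and> f \<le> - q)" for f
  proof
    assume "f \<in> F \<and> p < f \<and> f \<le> - q"
    then have "- f \<in> uminus ` F \<inter> {q..<- p}" by auto
    then show False using q(3) by blast
  qed
  then have "F \<inter> {p<..- q} = {}" by auto
  then show thesis using that[of "- q"] q(1,2) by simp
qed

section \<open>Dissections in coordinates and their symmetries\<close>

text \<open>Cell \<open>i\<close> is the box from \<open>(a i, c i)\<close> to
  \<open>(b i, d i)\<close>. The last assumption says that its interior meets the line
  \<open>x + y = N\<close>. The bounds and \<open>N\<close> are free parameters so that the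
  transposed and the rotated dissection are instances again.\<close>

locale diagonal_dissection =
  fixes I :: "'i set" and a b c d :: "'i \<Rightarrow> real" and L R B T N :: real
  assumes fin: "finite I"
    and width: "i \<in> I \<Longrightarrow> a i < b i"
    and height: "i \<in> I \<Longrightarrow> c i < d i"
    and inside: "i \<in> I \<Longrightarrow> L \<le> a i \<and> b i \<le> R \<and> B \<le> c i \<and> d i \<le> T"
    and separated: "i \<in> I \<Longrightarrow> j \<in> I \<Longrightarrow> i \<noteq> j \<Longrightarrow>
      b i \<le> a j \<or> b j \<le> a i \<or> d i \<le> c j \<or> d j \<le> c i"
    and covering: "L \<le> p \<Longrightarrow> p \<le> R \<Longrightarrow> B \<le> q \<Longrightarrow> q \<le> T \<Longrightarrow>
      \<exists>i\<in>I. a i \<le> p \<and> p \<le> b i \<and> c i \<le> q \<and> q \<le> d i"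
    and diag: "i \<in> I \<Longrightarrow> a i + c i < N \<and> N < b i + d i"
begin

text \<open>The strict inequalities say that the common boundary segment has positive
  length.\<close>

definition up :: "'i rel" where
  "up = {(x, y). x \<in> I \<and> y \<in> I \<and> d x = c y \<and> a x < b y \<and> a y < b x}"

definition right :: "'i rel" where
  "right = {(x, y). x \<in> I \<and> y \<in> I \<and> b x = a y \<and> c x < d y \<and> c y < d x}"

definition adj :: "'i rel" where "adj = up \<union> right"

lemma transpose: "diagonal_dissection I c d a b B T L R N"
proof
  fix p q assume "B \<le> p" "p \<le> T" "L \<le> q" "q \<le> R"
  then show "\<exists>i\<in>I. c i \<le> p \<and> p \<le> d i \<and> a i \<le> q \<and> q \<le> b i"
    using covering[of q p] by auto
next
  fix i j assume "i \<in> I" "j \<in> I" "i \<noteq> j"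
  then show "d i \<le> c j \<or> d j \<le> c i \<or> b i \<le> a j \<or> b j \<le> a i"
    using separated by blast
qed (use fin width height inside diag in \<open>auto simp: add.commute\<close>)

lemma rotate: "diagonal_dissection I (\<lambda>i. - b i) (\<lambda>i. - a i) (\<lambda>i. - d i) (\<lambda>i. - c i)
    (- R) (- L) (- T) (- B) (- N)"
proof
  fix p q assume "- R \<le> p" "p \<le> - L" "- T \<le> q" "q \<le> - B"
  then obtain i where "i \<in> I" "a i \<le> - p" "- p \<le> b i" "c i \<le> - q" "- q \<le> d i"
    using covering[of "- p" "- q"] by auto
  then show "\<exists>i\<in>I. - b i \<le> p \<and> p \<le> - a i \<and> - d i \<le> q \<and> q \<le> - c i"
    by (intro bexI[of _ i]) auto
next
  fix i j assume "i \<in> I" "j \<in> I" "i \<noteq> j"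
  then show "- a i \<le> - b j \<or> - a j \<le> - b i \<or> - c i \<le> - d j \<or> - c j \<le> - d i"
    using separated by auto
next
  fix i assume "i \<in> I"
  then show "- b i + - d i < - N \<and> - N < - a i + - c i" using diag[of i] by auto
qed (use fin width height inside in auto)

section \<open>Cells in a given quadrant at a point\<close>

text \<open>Take a cell at a point slightly to the lower left of \<open>(p, q)\<close>. No side
  coordinate lies in the gap between, so the cell extends to \<open>p\<close> and to
  \<open>q\<close>.\<close>

lemma lower_left_cell:
  assumes "L < p" "p \<le> R" "B < q" "q \<le> T"
  obtains i where "i \<in> I" "a i < p" "p \<le> b i" "c i < q" "q \<le> d i"
proof -
  obtain p' where p': "L < p'" "p' < p" "(a ` I \<union> b ` I) \<inter> {p'..<p} = {}"
    using gap_below[of "a ` I \<union> b ` I" L p] fin assms by auto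
  obtain q' where q': "B < q'" "q' < q" "(c ` I \<union> d ` I) \<inter> {q'..<q} = {}"
    using gap_below[of "c ` I \<union> d ` I" B q] fin assms by auto
  obtain i where i: "i \<in> I" "a i \<le> p'" "p' \<le> b i" "c i \<le> q'" "q' \<le> d i"
    using covering[of p' q'] p' q' assms by auto
  have "b i \<notin> {p'..<p}" "d i \<notin> {q'..<q}" using p' q' i by blast+
  then show thesis using i p' q' by (intro that[of i]) auto
qed

text \<open>Neither transposition nor rotation by 180 degrees carries the lower-left quadrant to the
  lower-right one, so the argument is repeated.\<close>

lemma lower_right_cell:
  assumes "L \<le> p" "p < R" "B < q" "q \<le> T"
  obtains i where "i \<in> I" "a i \<le> p" "p < b i" "c i < q" "q \<le> d i"
proof -
  obtain p' where p': "p < p'" "p' < R" "(a ` I \<union> b ` I) \<inter> {p<..p'} = {}"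
    using gap_above[of "a ` I \<union> b ` I" p R] fin assms by auto
  obtain q' where q': "B < q'" "q' < q" "(c ` I \<union> d ` I) \<inter> {q'..<q} = {}"
    using gap_below[of "c ` I \<union> d ` I" B q] fin assms by auto
  obtain i where i: "i \<in> I" "a i \<le> p'" "p' \<le> b i" "c i \<le> q'" "q' \<le> d i"
    using covering[of p' q'] p' q' assms by auto
  have "a i \<notin> {p<..p'}" "d i \<notin> {q'..<q}" using p' q' i by blast+
  then show thesis using i p' q' by (intro that[of i]) auto
qed

lemma upper_left_cell:
  assumes "L < p" "p \<le> R" "B \<le> q" "q < T"
  obtains i where "i \<in> I" "a i < p" "p \<le> b i" "c i \<le> q" "q < d i"
proof -
  interpret t: diagonal_dissection I c d a b B T L R N by (rule transpose)
  show thesis using t.lower_right_cell[of q p] assms that by metis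
qed

lemma upper_right_cell:
  assumes "L \<le> p" "p < R" "B \<le> q" "q < T"
  obtains i where "i \<in> I" "a i \<le> p" "p < b i" "c i \<le> q" "q < d i"
proof -
  interpret o: diagonal_dissection I "\<lambda>i. - b i" "\<lambda>i. - a i" "\<lambda>i. - d i" "\<lambda>i. - c i"
    "- R" "- L" "- T" "- B" "- N" by (rule rotate)
  obtain i where "i \<in> I" "- b i < - p" "- p \<le> - a i" "- d i < - q" "- q \<le> - c i"
    using o.lower_left_cell[of "- p" "- q"] assms by auto
  then show thesis by (intro that[of i]) auto
qed

section \<open>Acyclicity of adjacency\<close>

text \<open>Adjacent rectangles meet a common line of slope 1, so adjacency is contained in the order
  in which disjoint rectangles block each other when translated in the direction $(1,1)$.
  A rectangle with minimal \<open>b - c\<close> shares such a line with all its predecessors and successors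
  at once, hence can be eliminated from any cycle.\<close>

lemma acyclic_adj: "acyclic adj"
proof -
  \<comment> \<open>The difference of the coordinates maps the interior of cell \<open>x\<close>
    onto the open interval from \<open>a x - d x\<close> to \<open>b x - c x\<close>; the first two
    inequalities say that two such intervals overlap.\<close>
  define Q where "Q = {(x, y). a x - d x < b y - c y \<and> a y - d y < b x - c x \<and>
    (b x \<le> a y \<or> d x \<le> c y)}"
  have "acyclic (Restr Q I)"
  proof (rule acyclic_elimination[OF fin])
    fix U assume U: "U \<subseteq> I" "U \<noteq> {}"
    then have "finite U" using fin finite_subset by blast
    then obtain x where "is_arg_min (\<lambda>x. b x - c x) (\<lambda>x. x \<in> U) x"
      using U ex_is_arg_min_if_finite by metis
    then have x: "x \<in> U" and xm: "\<And>y. y \<in> U \<Longrightarrow> b x - c x \<le> b y - c y"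
      by (auto simp: is_arg_min_linorder)
    have pos: "a i < b i" "c i < d i" if "i \<in> U" for i
      using width[of i] height[of i] U that by auto
    have "(x, x) \<notin> Q" using pos[OF x] by (auto simp: Q_def)
    moreover have "(p, s) \<in> Q" if "p \<in> U" "s \<in> U" "(p, x) \<in> Q" "(x, s) \<in> Q" for p s
    proof -
      note f = pos[OF x] pos[OF that(1)] pos[OF that(2)] xm[OF that(1)] xm[OF that(2)]
      have "p \<noteq> s" using that f by (auto simp: Q_def)
      then have "b p \<le> a s \<or> d p \<le> c s \<or> b s \<le> a p \<or> d s \<le> c p"
        using separated[of p s] that U by blast
      moreover have ineqs: "a p - d p < b x - c x" "a x - d x < b p - c p" "b p \<le> a x \<or> d p \<le> c x"
        "a x - d x < b s - c s" "a s - d s < b x - c x" "b x \<le> a s \<or> d x \<le> c s"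
        using that(3,4) by (auto simp: Q_def)
      \<comment> \<open>Some line of slope 1 meets \<open>p\<close>, \<open>x\<close> and
        \<open>s\<close> in this order, so \<open>s\<close> cannot lie to the left of or below
        \<open>p\<close>.\<close>
      moreover have "\<not> b s \<le> a p" "\<not> d s \<le> c p"
        using ineqs f by linarith+
      ultimately show ?thesis using f by (auto simp: Q_def)
    qed
    ultimately show "\<exists>x\<in>U. (x, x) \<notin> Q \<and>
        (\<forall>p\<in>U. \<forall>s\<in>U. (p, x) \<in> Q \<longrightarrow> (x, s) \<in> Q \<longrightarrow> (p, s) \<in> Q)"
      using x by blast
  qed
  moreover have "(x, y) \<in> Restr Q I" if "(x, y) \<in> adj" for x y
  proof -
    have "x \<in> I" "y \<in> I" using that by (auto simp: adj_def up_def right_def)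
    then show ?thesis
      using that width[of x] height[of x] width[of y] height[of y]
      by (auto simp: adj_def up_def right_def Q_def)
  qed
  then have "adj \<subseteq> Restr Q I" by (rule subrelI)
  ultimately show ?thesis by (rule acyclic_subset)
qed

lemma antisym_adj: "antisym (adj\<^sup>*)"
  using acyclic_adj by (rule acyclic_impl_antisym_rtrancl)

lemma adj_subset: "adj \<subseteq> I \<times> I"
  by (auto simp: adj_def up_def right_def)

section \<open>Vertical position and the order\<close>

text \<open>Walk down from \<open>y\<close>: a suitable cell \<open>w\<close> directly under
  \<open>y\<close> is \<open>x\<close> itself or again lies above \<open>x\<close> and overlaps its
  horizontal range. Its bottom is lower than that of \<open>y\<close>, so the walk ends.\<close>

lemma below_imp_rtrancl_adj:
  assumes "x \<in> I" "y \<in> I" "a x < b y" "a y < b x" "d x \<le> c y"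
  shows "(x, y) \<in> adj\<^sup>*"
  using assms(2-)
proof (induction y rule: measure_induct_rule[of "\<lambda>y. card {z\<in>I. c z < c y}"])
  case (less y)
  \<comment> \<open>The right end of the common horizontal range: a cell to the lower left of
    \<open>(s, c y)\<close> overlaps both \<open>x\<close> and \<open>y\<close>
    horizontally.\<close>
  define s where "s = min (b x) (b y)"
  note f = width[OF assms(1)] height[OF assms(1)] inside[OF assms(1)]
    width[OF less.prems(1)] height[OF less.prems(1)] inside[OF less.prems(1)]
  have s: "a x < s" "a y < s" "s \<le> b x" "s \<le> b y" using f less.prems by (auto simp: s_def)
  have "L < s" "s \<le> R" "B < c y" "c y \<le> T" using s f less.prems by linarith+
  then obtain w where w: "w \<in> I" "a w < s" "s \<le> b w" "c w < c y" "c y \<le> d w"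
    using lower_left_cell by metis
  have "w \<noteq> y" using w by auto
  then have dw: "d w = c y"
    using separated[OF w(1) less.prems(1)] w f s by linarith
  then have wy: "(w, y) \<in> adj"
    using w less.prems s by (auto simp: adj_def up_def)
  show ?case
  proof (cases "w = x")
    case True
    then show ?thesis using wy by blast
  next
    case False
    then have "d x \<le> c w"
      using separated[OF w(1) assms(1)] w f s less.prems dw by linarith
    moreover have "card {z\<in>I. c z < c w} < card {z\<in>I. c z < c y}"
      using w fin by (intro psubset_card_mono) auto
    ultimately have "(x, w) \<in> adj\<^sup>*"
      using less.IH[of w] w s by auto
    then show ?thesis using wy by (meson rtrancl.rtrancl_into_rtrancl)
  qed
qed

section \<open>Covering relations of the adjacency order\<close>

text \<open>If one could go from \<open>x\<close> to \<open>y\<close> via other rectangles, one would arrive at \<open>y\<close> from the left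
  of the vertical line through the left sides of \<open>x\<close> and \<open>y\<close>. A rectangle on the way that crosses
  this line lies below \<open>x\<close> or above \<open>y\<close>, which closes a cycle.\<close>

lemma no_between_aligned_left:
  assumes "x \<in> I" "y \<in> I" "d x = c y" "a x = a y" "b y \<le> b x"
    and "(x, z) \<in> adj\<^sup>*" "(z, y) \<in> adj\<^sup>*" "z \<noteq> x" "z \<noteq> y"
  shows False
proof -
  note f = width[OF assms(1)] height[OF assms(1)] width[OF assms(2)] height[OF assms(2)]
  obtain v where v: "(z, v) \<in> adj\<^sup>*" "(v, y) \<in> adj"
    using assms by (meson rtranclE)
  then have "v \<noteq> x" using assms antisym_adj by (metis antisymD)
  have vI: "v \<in> I" using v adj_subset by auto
  have xv: "(x, v) \<in> adj\<^sup>*" using assms v by auto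
  \<comment> \<open>The bottom of \<open>y\<close> lies within the top of \<open>x\<close>, so no
    cell other than \<open>x\<close> touches \<open>y\<close> from below, and \<open>v\<close> must
    touch it from the left.\<close>
  have bv: "b v = a y"
    using v(2) separated[OF vI assms(1) \<open>v \<noteq> x\<close>] f assms(3-5) height[OF vI]
    by (auto simp: adj_def up_def right_def)
  \<comment> \<open>Backward induction along a path from \<open>x\<close> to \<open>v\<close>; at
    its start \<open>w = x\<close> the bound is absurd.\<close>
  have "b w \<le> a x" if "(w, v) \<in> adj\<^sup>*" "(x, w) \<in> adj\<^sup>*" for w
    using that
  proof (induction rule: converse_rtrancl_induct)
    case base
    then show ?case using bv assms by simp
  next
    case (step w u)
    then have bu: "b u \<le> a x" by (meson rtrancl.rtrancl_into_rtrancl)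
    have I: "w \<in> I" "u \<in> I" using step adj_subset by auto
    show ?case
    proof (rule ccontr)
      assume crossing: "\<not> b w \<le> a x"
      \<comment> \<open>As \<open>u\<close> ends left of the line and \<open>w\<close> does not, the
        step from \<open>w\<close> to \<open>u\<close> is an \<open>up\<close> step, so
        \<open>w\<close> starts left of the line.\<close>
      then have aw: "a w < a x"
        using step.hyps bu width[OF I(2)] by (auto simp: adj_def up_def right_def)
      then have "w \<noteq> x" "w \<noteq> y" using assms by auto
      then consider "d w \<le> c x" | "d y \<le> c w"
        using separated[OF I(1) assms(1)] separated[OF I(1) assms(2)] crossing aw f assms(3-5)
          height[OF I(1)] by fastforce
      then show False
      proof cases
        case 1
        then have "(w, x) \<in> adj\<^sup>*"
          using below_imp_rtrancl_adj[of w x] I assms crossing aw f by auto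
        then show ?thesis using step.prems antisym_adj \<open>w \<noteq> x\<close> by (metis antisymD)
      next
        case 2
        then have "(y, w) \<in> adj\<^sup>*"
          using below_imp_rtrancl_adj[of y w] I assms crossing aw f by auto
        moreover have "(w, y) \<in> adj\<^sup>*"
          using step.hyps v by (meson converse_rtrancl_into_rtrancl rtrancl.rtrancl_into_rtrancl)
        ultimately show ?thesis using antisym_adj \<open>w \<noteq> y\<close> by (metis antisymD)
      qed
    qed
  qed
  then have "b x \<le> a x" using xv by blast
  then show False using f by simp
qed

text \<open>The weak inequalities merge the two corner configurations with the one where the full
  sides coincide.\<close>

definition aligned_up :: "'i \<Rightarrow> 'i \<Rightarrow> bool" where
  "aligned_up x y \<longleftrightarrow> d x = c y \<and> (a x = a y \<and> b y \<le> b x \<or> b x = b y \<and> a y \<le> a x)"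

text \<open>Rotation by 180 degrees reverses adjacency, exchanges \<open>x\<close> and
  \<open>y\<close>, and turns alignment on the right into alignment on the left.\<close>

lemma no_between_aligned_up:
  assumes "x \<in> I" "y \<in> I" "aligned_up x y"
    and "(x, z) \<in> adj\<^sup>*" "(z, y) \<in> adj\<^sup>*" "z \<noteq> x" "z \<noteq> y"
  shows False
proof (cases "a x = a y \<and> b y \<le> b x")
  case True
  then show ?thesis using no_between_aligned_left[of x y z] assms by (auto simp: aligned_up_def)
next
  case False
  interpret o: diagonal_dissection I "\<lambda>i. - b i" "\<lambda>i. - a i" "\<lambda>i. - d i" "\<lambda>i. - c i"
    "- R" "- L" "- T" "- B" "- N" by (rule rotate)
  have "o.adj = adj\<inverse>"
    by (auto simp: o.adj_def o.up_def o.right_def adj_def up_def right_def)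
  then show ?thesis
    using False o.no_between_aligned_left[of y x z] assms
    by (auto simp: aligned_up_def rtrancl_converse)
qed

lemma aligned_up_imp_up: "x \<in> I \<Longrightarrow> y \<in> I \<Longrightarrow> aligned_up x y \<Longrightarrow> (x, y) \<in> up"
  using width[of x] width[of y] by (auto simp: aligned_up_def up_def)

text \<open>If neither end of the common segment can be bypassed, the segment runs from \<open>a x\<close> to \<open>b y\<close>.
  Then the rectangle to the left of \<open>x\<close> puts the left end of the segment above the diagonal and
  the rectangle to the right of \<open>y\<close> puts its right end below the diagonal, which is absurd.\<close>

lemma up_not_aligned_imp_between:
  assumes "(x, y) \<in> up" "\<not> aligned_up x y"
  obtains z where "(x, z) \<in> adj" "(z, y) \<in> adj"
proof -
  have xy: "x \<in> I" "y \<in> I" "d x = c y" "a x < b y" "a y < b x" using assms by (auto simp: up_def)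
  note f = width[OF xy(1)] height[OF xy(1)] inside[OF xy(1)]
    width[OF xy(2)] height[OF xy(2)] inside[OF xy(2)]
  consider "b x < b y" | "a x < a y" | "a y < a x" "b y < b x"
    using assms(2) xy(3) unfolding aligned_up_def by linarith
  then show thesis
  proof cases
    case 1
    \<comment> \<open>Here \<open>y\<close> protrudes to the right over \<open>x\<close>; the cell
      under \<open>y\<close> at the upper-right corner of \<open>x\<close> touches both.\<close>
    obtain z where z: "z \<in> I" "a z \<le> b x" "b x < b z" "c z < c y" "c y \<le> d z"
      using lower_right_cell[of "b x" "c y"] f xy 1 by auto
    then have "z \<noteq> x" "z \<noteq> y" by auto
    have "a z = b x" using separated[OF z(1) xy(1) \<open>z \<noteq> x\<close>] z xy f by auto
    moreover have "d z = c y" using separated[OF z(1) xy(2) \<open>z \<noteq> y\<close>] z xy f 1 by auto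
    ultimately show thesis
      using z xy f 1 by (intro that[of z]) (auto simp: adj_def up_def right_def)
  next
    case 2
    \<comment> \<open>Here \<open>x\<close> protrudes to the left under \<open>y\<close>; the cell
      on \<open>x\<close> at the lower-left corner of \<open>y\<close> touches both.\<close>
    obtain z where z: "z \<in> I" "a z < a y" "a y \<le> b z" "c z \<le> c y" "c y < d z"
      using upper_left_cell[of "a y" "c y"] f xy 2 by auto
    then have "z \<noteq> x" "z \<noteq> y" using xy by auto
    have "b z = a y" using separated[OF z(1) xy(2) \<open>z \<noteq> y\<close>] z xy f by auto
    moreover have "c z = c y" using separated[OF z(1) xy(1) \<open>z \<noteq> x\<close>] z xy f 2 by auto
    ultimately show thesis
      using z xy f 2 by (intro that[of z]) (auto simp: adj_def up_def right_def)
  next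
    case 3
    obtain w where w: "w \<in> I" "a w < a x" "a x \<le> b w" "c w < c y" "c y \<le> d w"
      using lower_left_cell[of "a x" "c y"] f xy 3 by auto
    then have "w \<noteq> x" "w \<noteq> y" by auto
    have "b w = a x" using separated[OF w(1) xy(1) \<open>w \<noteq> x\<close>] w xy f by auto
    moreover have "d w = c y" using separated[OF w(1) xy(2) \<open>w \<noteq> y\<close>] w xy f 3 by auto
    \<comment> \<open>The point \<open>(a x, c y)\<close> is the upper-right corner of
      \<open>w\<close>; below, \<open>(b y, c y)\<close> is the lower-left corner of
      \<open>v\<close>.\<close>
    ultimately have "N < a x + c y" using diag[OF w(1)] by simp
    obtain v where v: "v \<in> I" "a v \<le> b y" "b y < b v" "c v \<le> c y" "c y < d v"
      using upper_right_cell[of "b y" "c y"] f xy 3 by auto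
    then have "v \<noteq> x" "v \<noteq> y" using xy by auto
    have "a v = b y" using separated[OF v(1) xy(2) \<open>v \<noteq> y\<close>] v xy f by auto
    moreover have "c v = c y" using separated[OF v(1) xy(1) \<open>v \<noteq> x\<close>] v xy f 3 by auto
    ultimately have "b y + c y < N" using diag[OF v(1)] by simp
    then show thesis using \<open>N < a x + c y\<close> xy by simp
  qed
qed

definition aligned_right :: "'i \<Rightarrow> 'i \<Rightarrow> bool" where
  "aligned_right x y \<longleftrightarrow> b x = a y \<and> (c x = c y \<and> d y \<le> d x \<or> d x = d y \<and> c y \<le> c x)"

text \<open>A cover in the closure of an acyclic relation is a single step that does not factor into
  two; transposition reduces \<open>right\<close> steps to \<open>up\<close> steps.\<close>

lemma covered_by_adj_iff:
  assumes "x \<in> I" "y \<in> I"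
  shows "covered_by (adj\<^sup>*) x y \<longleftrightarrow> aligned_up x y \<or> aligned_right x y"
proof -
  interpret t: diagonal_dissection I c d a b B T L R N by (rule transpose)
  have t_adj: "t.adj = adj" and t_up: "t.up = right" and t_aligned: "t.aligned_up = aligned_right"
    by (auto simp: t.adj_def t.up_def t.right_def adj_def up_def right_def
        t.aligned_up_def aligned_right_def fun_eq_iff)
  have irrefl: "(z, z) \<notin> adj" for z using acyclic_adj by (auto simp: acyclic_def)
  show ?thesis
  proof
    assume cov: "covered_by (adj\<^sup>*) x y"
    have no_mid: "\<not> ((x, z) \<in> adj \<and> (z, y) \<in> adj\<^sup>* \<and> z \<noteq> y)" for z
      using cov irrefl[of x] unfolding covered_by_def strictly_below_def by (metis r_into_rtrancl)
    obtain z where "(x, z) \<in> adj" "(z, y) \<in> adj\<^sup>*"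
      using cov unfolding covered_by_def strictly_below_def by (metis converse_rtranclE)
    then have "(x, y) \<in> adj" using no_mid by metis
    moreover
    have no_mid': "\<not> ((x, z) \<in> adj \<and> (z, y) \<in> adj)" for z
      using no_mid[of z] irrefl[of y] by blast
    ultimately consider "(x, y) \<in> up" | "(x, y) \<in> right" unfolding adj_def by blast
    then show "aligned_up x y \<or> aligned_right x y"
    proof cases
      case 1
      then show ?thesis using up_not_aligned_imp_between no_mid' by metis
    next
      case 2
      then show ?thesis
        using t.up_not_aligned_imp_between[unfolded t_adj t_up t_aligned] no_mid' by metis
    qed
  next
    assume al: "aligned_up x y \<or> aligned_right x y"
    then have "(x, y) \<in> adj"
      using aligned_up_imp_up t.aligned_up_imp_up assms unfolding t_up t_aligned adj_def by blast
    then have "strictly_below (adj\<^sup>*) x y"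
      using irrefl by (auto simp: strictly_below_def)
    then show "covered_by (adj\<^sup>*) x y"
      using no_between_aligned_up[OF assms] t.no_between_aligned_up[OF assms] al
      unfolding t_adj t_aligned covered_by_def strictly_below_def by metis
  qed
qed

end

section \<open>Sides and interiors of planar boxes\<close>

lemma rel_interior_horizontal:
  fixes a b c :: real
  assumes "a < b"
  shows "rel_interior (closed_segment (a, c) (b, c)) = {a<..<b} \<times> {c}"
  using assms
  by (simp add: closed_segment_same_snd rel_interior_Times rel_interior_closed_segment open_segment_eq_real_ivl)

lemma rel_interior_vertical:
  fixes a c d :: real
  assumes "c < d"
  shows "rel_interior (closed_segment (a, c) (a, d)) = {a} \<times> {c<..<d}"
  using assms
  by (simp add: closed_segment_same_fst rel_interior_Times rel_interior_closed_segment open_segment_eq_real_ivl)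

lemma greaterThanLessThan_Int_nonempty_iff:
  fixes a b a' b' :: real
  assumes "a < b" "a' < b'"
  shows "{a<..<b} \<inter> {a'<..<b'} \<noteq> {} \<longleftrightarrow> a < b' \<and> a' < b"
proof -
  have "{a<..<b} \<inter> {a'<..<b'} = {max a a'<..<min b b'}" by auto
  then show ?thesis using assms by auto
qed

lemma box_Pair_Int_empty_iff:
  fixes a b c d a' b' c' d' :: real
  assumes "a < b" "c < d" "a' < b'" "c' < d'"
  shows "box (a, c) (b, d) \<inter> box (a', c') (b', d') = {} \<longleftrightarrow>
    b \<le> a' \<or> b' \<le> a \<or> d \<le> c' \<or> d' \<le> c"
  unfolding disjoint_interval(4) Basis_prod_def using assms by auto

text \<open>The last two disjuncts are transversal crossings, of a bottom with a right side and of a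
  left with a top side.\<close>

lemma open_sides_meet_iff:
  fixes a b c d a' b' c' d' :: real
  assumes "a < b" "c < d" "a' < b'" "c' < d'"
  shows "({a'<..<b'} \<times> {c'} \<union> {a'} \<times> {c'<..<d'}) \<inter> ({a<..<b} \<times> {d} \<union> {b} \<times> {c<..<d}) \<noteq> {} \<longleftrightarrow>
    d = c' \<and> a < b' \<and> a' < b \<or> b = a' \<and> c < d' \<and> c' < d \<or>
    a' < b \<and> b < b' \<and> c < c' \<and> c' < d \<or> a < a' \<and> a' < b \<and> c' < d \<and> d < d'"
proof -
  have distrib: "(U \<union> V) \<inter> (X \<union> Y) \<noteq> {} \<longleftrightarrow>
      U \<inter> X \<noteq> {} \<or> V \<inter> Y \<noteq> {} \<or> U \<inter> Y \<noteq> {} \<or> V \<inter> X \<noteq> {}" for U V X Y :: "(real \<times> real) set"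
    by blast
  have bottom_top: "({a'<..<b'} \<times> {c'}) \<inter> ({a<..<b} \<times> {d}) \<noteq> {} \<longleftrightarrow> d = c' \<and> a < b' \<and> a' < b"
    unfolding Times_Int_Times Times_empty
    using greaterThanLessThan_Int_nonempty_iff[OF assms(1,3)] by auto
  have left_right: "({a'} \<times> {c'<..<d'}) \<inter> ({b} \<times> {c<..<d}) \<noteq> {} \<longleftrightarrow> b = a' \<and> c < d' \<and> c' < d"
    unfolding Times_Int_Times Times_empty
    using greaterThanLessThan_Int_nonempty_iff[OF assms(2,4)] by auto
  have bottom_right: "({a'<..<b'} \<times> {c'}) \<inter> ({b} \<times> {c<..<d}) \<noteq> {} \<longleftrightarrow>
      a' < b \<and> b < b' \<and> c < c' \<and> c' < d"
    unfolding Times_Int_Times Times_empty by auto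
  have left_top: "({a'} \<times> {c'<..<d'}) \<inter> ({a<..<b} \<times> {d}) \<noteq> {} \<longleftrightarrow>
      a < a' \<and> a' < b \<and> c' < d \<and> d < d'"
    unfolding Times_Int_Times Times_empty by auto
  show ?thesis
    unfolding distrib bottom_top left_right bottom_right left_top ..
qed

lemma sides_eq_Times:
  assumes "xmin A < xmax A" "ymin A < ymax A"
  shows "bottom_side A = {xmin A..xmax A} \<times> {ymin A}"
    and "top_side A = {xmin A..xmax A} \<times> {ymax A}"
    and "left_side A = {xmin A} \<times> {ymin A..ymax A}"
    and "right_side A = {xmax A} \<times> {ymin A..ymax A}"
  unfolding bottom_side_def top_side_def left_side_def right_side_def
    lower_left_def lower_right_def upper_left_def upper_right_def
  using assms
  by (simp_all add: closed_segment_same_fst closed_segment_same_snd closed_segment_eq_real_ivl)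

lemma rel_interior_sides:
  assumes "xmin A < xmax A" "ymin A < ymax A"
  shows "rel_interior (bottom_side A) = {xmin A<..<xmax A} \<times> {ymin A}"
    and "rel_interior (top_side A) = {xmin A<..<xmax A} \<times> {ymax A}"
    and "rel_interior (left_side A) = {xmin A} \<times> {ymin A<..<ymax A}"
    and "rel_interior (right_side A) = {xmax A} \<times> {ymin A<..<ymax A}"
  unfolding bottom_side_def top_side_def left_side_def right_side_def
    lower_left_def lower_right_def upper_left_def upper_right_def
  using assms by (simp_all only: rel_interior_horizontal rel_interior_vertical)

section \<open>From rectangulations to dissections\<close>

text \<open>An interior point on the diagonal lies strictly between the lower-left and the
  upper-right corner in both coordinates, which makes the box nondegenerate and puts the two corners
  on opposite sides of the diagonal.\<close>

lemma diagonal_rectangulation_cell: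
  assumes "diagonal_rectangulation n D" "A \<in> D"
  shows "A = cbox (xmin A, ymin A) (xmax A, ymax A)"
    and "xmin A < xmax A" and "ymin A < ymax A"
    and "0 \<le> xmin A" and "xmax A \<le> real n" and "0 \<le> ymin A" and "ymax A \<le> real n"
    and "xmin A + ymin A < real n" and "real n < xmax A + ymax A"
proof -
  have div: "D division_of cbox (0, 0) (real n, real n)" and "interior A \<inter> diagonal n \<noteq> {}"
    using assms by (auto simp: diagonal_rectangulation_def)
  then obtain l u where A: "A = cbox l u" "cbox l u \<noteq> {}"
    using assms(2) by (metis division_ofD(3,4))
  then have eq: "l = (xmin A, ymin A)" "u = (xmax A, ymax A)"
    by simp_all
  show box: "A = cbox (xmin A, ymin A) (xmax A, ymax A)"
    using A eq by metis
  obtain p where p: "p \<in> interior A" "p \<in> diagonal n"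
    using \<open>interior A \<inter> diagonal n \<noteq> {}\<close> by blast
  have "fst p + snd p = real n"
    using p(2) by (auto simp: diagonal_def closed_segment_def algebra_simps)
  moreover have "p \<in> box (xmin A, ymin A) (xmax A, ymax A)"
    using p(1) box by (metis interior_cbox)
  ultimately show lt: "xmin A < xmax A" "ymin A < ymax A"
    and "xmin A + ymin A < real n" "real n < xmax A + ymax A"
    by (auto simp: box_prod mem_Times_iff)
  have "(xmin A, ymin A) \<in> cbox (xmin A, ymin A) (xmax A, ymax A)"
    "(xmax A, ymax A) \<in> cbox (xmin A, ymin A) (xmax A, ymax A)"
    unfolding cbox_Pair_iff using lt by simp_all
  then have "(xmin A, ymin A) \<in> A" "(xmax A, ymax A) \<in> A"
    by (simp_all only: box[symmetric])
  then have "(xmin A, ymin A) \<in> cbox (0, 0) (real n, real n)"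
    "(xmax A, ymax A) \<in> cbox (0, 0) (real n, real n)"
    using division_ofD(2)[OF div assms(2)] by blast+
  then show "0 \<le> xmin A" "xmax A \<le> real n" "0 \<le> ymin A" "ymax A \<le> real n"
    by (auto simp: cbox_Pair_eq)
qed

lemma diagonal_dissection_cells:
  assumes "diagonal_rectangulation n D" "bij_betw r I D"
  shows "diagonal_dissection I (\<lambda>i. xmin (r i)) (\<lambda>i. xmax (r i)) (\<lambda>i. ymin (r i))
    (\<lambda>i. ymax (r i)) 0 (real n) 0 (real n) (real n)"
proof -
  have rD: "r i \<in> D" if "i \<in> I" for i using assms(2) that by (auto simp: bij_betw_def)
  note cell = diagonal_rectangulation_cell[OF assms(1) rD]
  have div: "D division_of cbox (0, 0) (real n, real n)"
    using assms by (simp add: diagonal_rectangulation_def)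
  show ?thesis
  proof (rule diagonal_dissection.intro)
    show "finite I"
      using bij_betw_finite[OF assms(2)] division_of_finite[OF div] by simp
  next
    fix i j assume ij: "i \<in> I" "j \<in> I" "i \<noteq> j"
    then have "r i \<noteq> r j" using assms(2) by (auto simp: bij_betw_def inj_on_def)
    then have "interior (r i) \<inter> interior (r j) = {}"
      using division_ofD(5)[OF div rD rD] ij by blast
    then have "box (xmin (r i), ymin (r i)) (xmax (r i), ymax (r i)) \<inter>
        box (xmin (r j), ymin (r j)) (xmax (r j), ymax (r j)) = {}"
      using cell(1)[OF ij(1)] cell(1)[OF ij(2)] by (metis interior_cbox)
    then show "xmax (r i) \<le> xmin (r j) \<or> xmax (r j) \<le> xmin (r i) \<or>
        ymax (r i) \<le> ymin (r j) \<or> ymax (r j) \<le> ymin (r i)"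
      using box_Pair_Int_empty_iff cell(2,3)[OF ij(1)] cell(2,3)[OF ij(2)] by metis
  next
    fix p q :: real
    assume "0 \<le> p" "p \<le> real n" "0 \<le> q" "q \<le> real n"
    then have "(p, q) \<in> \<Union>D" using division_ofD(6)[OF div] by (auto simp: cbox_Pair_eq)
    then obtain i where i: "i \<in> I" "(p, q) \<in> r i"
      using assms(2) by (auto simp: bij_betw_def)
    then have "(p, q) \<in> cbox (xmin (r i), ymin (r i)) (xmax (r i), ymax (r i))"
      using cell(1) by metis
    then show "\<exists>i\<in>I. xmin (r i) \<le> p \<and> p \<le> xmax (r i) \<and> ymin (r i) \<le> q \<and> q \<le> ymax (r i)"
      using i(1) unfolding cbox_Pair_iff by auto
  qed (use cell(2-) in auto)
qed

theorem theorem3p2: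
  fixes n :: nat and D :: "(real \<times> real) set set"
    and r :: "nat \<Rightarrow> (real \<times> real) set" and x y :: nat
  assumes "diagonal_rectangulation n D"
    and "diagonal_labelling n D r"
    and "x \<in> {1..n}" and "y \<in> {1..n}"
  shows "covered_by (adjacency_poset n r) x y \<longleftrightarrow>
      (upper_left (r x) = lower_left (r y) \<and> xmax (r y) < xmax (r x)) \<or>
      (lower_right (r x) = lower_left (r y) \<and> ymax (r y) < ymax (r x)) \<or>
      top_side (r x) = bottom_side (r y) \<or>
      right_side (r x) = left_side (r y) \<or>
      (upper_right (r x) = lower_right (r y) \<and> xmin (r y) < xmin (r x)) \<or>
      (upper_right (r x) = upper_left (r y) \<and> ymin (r y) < ymin (r x))"
proof -
  define I where "I = {1..n}"
  interpret diagonal_dissection I "\<lambda>i. xmin (r i)" "\<lambda>i. xmax (r i)" "\<lambda>i. ymin (r i)"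
    "\<lambda>i. ymax (r i)" 0 "real n" 0 "real n" "real n"
    using diagonal_dissection_cells assms(1,2) unfolding I_def diagonal_labelling_def by blast
  have xy: "x \<in> I" "y \<in> I" using assms(3,4) by (simp_all add: I_def)
  note adjacency_I = adjacency_def[of n r, folded I_def]
    and poset_I = adjacency_poset_def[of n r, folded I_def]
  have "(u, v) \<in> adjacency n r \<longleftrightarrow> (u, v) \<in> adj" for u v
  proof (cases "u \<in> I \<and> v \<in> I")
    case False
    then show ?thesis by (auto simp: adjacency_I adj_def up_def right_def)
  next
    case True
    then have uv: "u \<in> I" "v \<in> I" by auto
    note f = width[OF uv(1)] width[OF uv(2)] height[OF uv(1)] height[OF uv(2)]
    \<comment> \<open>At a transversal crossing the interiors of both cells would overlap.\<close>
    have no_cross: "\<not> (xmin (r v) < xmax (r u) \<and> xmax (r u) < xmax (r v) \<and>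
          ymin (r u) < ymin (r v) \<and> ymin (r v) < ymax (r u))"
      "\<not> (xmin (r u) < xmin (r v) \<and> xmin (r v) < xmax (r u) \<and>
          ymin (r v) < ymax (r u) \<and> ymax (r u) < ymax (r v))"
      using separated[OF uv] f by (cases "u = v"; auto)+
    have "(u, v) \<in> adjacency n r \<longleftrightarrow>
        (rel_interior (bottom_side (r v)) \<union> rel_interior (left_side (r v))) \<inter>
        (rel_interior (top_side (r u)) \<union> rel_interior (right_side (r u))) \<noteq> {}"
      unfolding adjacency_I using uv by blast
    also have "\<dots> \<longleftrightarrow> (u, v) \<in> up \<or> (u, v) \<in> right"
      unfolding rel_interior_sides[OF f(1,3)] rel_interior_sides[OF f(2,4)]
        open_sides_meet_iff[OF f(1,3,2,4)] up_def right_def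
      using uv no_cross by blast
    finally show ?thesis unfolding adj_def by blast
  qed
  then have adjacency_eq: "adjacency n r = adj" by auto
  note sides = sides_eq_Times[OF width[OF xy(1)] height[OF xy(1)]]
    sides_eq_Times[OF width[OF xy(2)] height[OF xy(2)]]
  have top_eq_bottom: "top_side (r x) = bottom_side (r y) \<longleftrightarrow>
      xmin (r x) = xmin (r y) \<and> xmax (r x) = xmax (r y) \<and> ymax (r x) = ymin (r y)"
    unfolding sides times_eq_iff Icc_eq_Icc using width[OF xy(1)] by auto
  have right_eq_left: "right_side (r x) = left_side (r y) \<longleftrightarrow>
      xmax (r x) = xmin (r y) \<and> ymin (r x) = ymin (r y) \<and> ymax (r x) = ymax (r y)"
    unfolding sides times_eq_iff Icc_eq_Icc using height[OF xy(1)] by auto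
  \<comment> \<open>Outside \<open>I\<close> the closure contains only reflexive pairs, so
    restricting it leaves the strict order unchanged.\<close>
  have "strictly_below (adj\<^sup>*) u v \<Longrightarrow> u \<in> I \<and> v \<in> I" for u v
    using trancl_subset_Sigma[OF adj_subset]
    by (auto simp: strictly_below_def rtrancl_eq_or_trancl)
  then have "strictly_below (adjacency_poset n r) = strictly_below (adj\<^sup>*)"
    by (auto simp: poset_I adjacency_eq strictly_below_def fun_eq_iff)
  then have "covered_by (adjacency_poset n r) x y \<longleftrightarrow> covered_by (adj\<^sup>*) x y"
    by (simp add: covered_by_def)
  also have "\<dots> \<longleftrightarrow> aligned_up x y \<or> aligned_right x y"
    using covered_by_adj_iff xy by blast
  \<comment> \<open>Each weak inequality splits into a strict case, a corner configuration, and an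
    equality; the two equalities of one alignment both say that the full sides coincide.\<close>
  also have "\<dots> \<longleftrightarrow> (upper_left (r x) = lower_left (r y) \<and> xmax (r y) < xmax (r x)) \<or>
      (lower_right (r x) = lower_left (r y) \<and> ymax (r y) < ymax (r x)) \<or>
      top_side (r x) = bottom_side (r y) \<or>
      right_side (r x) = left_side (r y) \<or>
      (upper_right (r x) = lower_right (r y) \<and> xmin (r y) < xmin (r x)) \<or>
      (upper_right (r x) = upper_left (r y) \<and> ymin (r y) < ymin (r x))"
    unfolding top_eq_bottom right_eq_left aligned_up_def aligned_right_def
      lower_left_def lower_right_def upper_left_def upper_right_def prod.inject
    by argo
  finally show ?thesis .
qed

end
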